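(* Let $(X,d)$ be a metric space and let $g:X\to X$. Assume that there exist $k\in(0,1)$ and a metric-preserving function $f:[0,\infty)\to[0,\infty)$ satisfying the following conditions: (a) for each $x\in X$ there exists $\varepsilon>0$ such that for every $u\in X$, $d(x,u)<\varepsilon$ implies $f(d(g(x),g(u)))\le k\,d(x,u)$; (b$'$) there exists $c\in(0,1)$ such that $f(ct)\ge kt$ for all sufficiently small $t>0$. Then $g$ is a local radial contraction on $(X,d)$.
   Context: A function $f:[0,\infty)\to[0,\infty)$ is metric-preserving if for every metric space $(Y,\rho)$, the composition $f\circ\rho$ is a metric on $Y$. A map $g:X\to X$ on a metric space $(X,d)$ is a local radial contraction if there exists $q\in(0,1)$ such that for each $x\in X$ there exists $\varepsilon>0$ such that for every $u\in X$, $d(x,u)<\varepsilon$ implies $d(g(x),g(u))\le q\,d(x,u)$. *)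

theory Defs
  imports "HOL-Analysis.Analysis"
begin

text \<open>
  A HOL formula cannot quantify over types, so the metric spaces in the definition below range over
  all carriers \<open>M :: real set\<close>. The lemma \<open>metric_preserving_iff\<close> shows that replacing
  \<open>real\<close> by any infinite type gives the same notion, and \<open>metric_preservingD\<close> that a
  metric-preserving function transforms metrics on carriers of every type into metrics.
  Values of \<open>f\<close> at negative arguments are irrelevant.
\<close>

definition metric_preserving :: "(real \<Rightarrow> real) \<Rightarrow> bool" where
  "metric_preserving f \<longleftrightarrow>
     f \<in> {0..} \<rightarrow> {0..} \<and>
     (\<forall>(M :: real set) \<rho>. Metric_space M \<rho> \<longrightarrow> Metric_space M (\<lambda>x y. f (\<rho> x y)))"

definition local_radial_contraction :: "'a set \<Rightarrow> ('a \<Rightarrow> 'a \<Rightarrow> real) \<Rightarrow> ('a \<Rightarrow> 'a) \<Rightarrow> bool" where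
  "local_radial_contraction X d g \<longleftrightarrow>
     g \<in> X \<rightarrow> X \<and>
     (\<exists>q. 0 < q \<and> q < 1 \<and>
       (\<forall>x\<in>X. \<exists>\<epsilon>>0. \<forall>u\<in>X. d x u < \<epsilon> \<longrightarrow> d (g x) (g u) \<le> q * d x u))"

lemma metric_preserving_transfer:
  fixes M :: "'b set" and f :: "real \<Rightarrow> real"
  assumes inf: "infinite (UNIV :: 'c set)"
    and f: "f \<in> {0..} \<rightarrow> {0..}"
    and pres: "\<And>(N :: 'c set) \<sigma>. Metric_space N \<sigma> \<Longrightarrow> Metric_space N (\<lambda>x y. f (\<sigma> x y))"
    and M: "Metric_space M \<rho>"
  shows "Metric_space M (\<lambda>x y. f (\<rho> x y))"
proof -
  interpret M: Metric_space M \<rho> by (fact M)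
  have sub: "Metric_space S (\<lambda>x y. f (\<rho> x y))" if S: "finite S" "S \<subseteq> M" for S
  proof -
    obtain N :: "'c set" where N: "finite N" "card N = card S"
      using infinite_arbitrarily_large[OF inf] by blast
    then obtain h where h: "bij_betw h S N"
      using finite_same_card_bij S(1) by metis
    define i where "i = inv_into S h"
    have i: "i a \<in> S" "i a \<in> M" if "a \<in> N" for a
      using that h S(2) unfolding i_def bij_betw_def by (auto intro: inv_into_into)
    have inj: "i a = i b \<longleftrightarrow> a = b" if "a \<in> N" "b \<in> N" for a b
      using that h unfolding i_def by (metis bij_betw_inv_into_right)
    have ih: "i (h x) = x" "h x \<in> N" if "x \<in> S" for x
      using that h unfolding i_def by (auto simp: bij_betw_def)
    have "Metric_space N (\<lambda>a b. \<rho> (i a) (i b))"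
      by unfold_locales (auto simp: i inj M.commute intro: M.triangle)
    then interpret N: Metric_space N "\<lambda>a b. f (\<rho> (i a) (i b))"
      by (rule pres)
    show ?thesis
    proof
      show "0 \<le> f (\<rho> x y)" for x y
        using f by (auto simp: Pi_iff)
      show "f (\<rho> x y) = f (\<rho> y x)" for x y
        by (simp add: M.commute)
      show "f (\<rho> x y) = 0 \<longleftrightarrow> x = y" if "x \<in> S" "y \<in> S" for x y
        using N.zero[of "h x" "h y"] that by (simp add: ih) (metis ih(1))
      show "f (\<rho> x z) \<le> f (\<rho> x y) + f (\<rho> y z)" if "x \<in> S" "y \<in> S" "z \<in> S" for x y z
        using N.triangle[of "h x" "h y" "h z"] that by (simp add: ih)
    qed
  qed
  show ?thesis
  proof
    show "0 \<le> f (\<rho> x y)" for x y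
      using f by (auto simp: Pi_iff)
    show "f (\<rho> x y) = f (\<rho> y x)" for x y
      by (simp add: M.commute)
    show "f (\<rho> x y) = 0 \<longleftrightarrow> x = y" if "x \<in> M" "y \<in> M" for x y
      using Metric_space.zero[OF sub[of "{x, y}"], of x y] that by simp
    show "f (\<rho> x z) \<le> f (\<rho> x y) + f (\<rho> y z)" if "x \<in> M" "y \<in> M" "z \<in> M" for x y z
      using Metric_space.triangle[OF sub[of "{x, y, z}"], of x y z] that by simp
  qed
qed

lemma metric_preservingD:
  fixes M :: "'b set"
  assumes "metric_preserving f" and "Metric_space M \<rho>"
  shows "Metric_space M (\<lambda>x y. f (\<rho> x y))"
  using assms metric_preserving_transfer[where 'c = real, OF infinite_UNIV_char_0]
  unfolding metric_preserving_def by blast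

lemma metric_preserving_iff:
  assumes "infinite (UNIV :: 'b set)"
  shows "metric_preserving f \<longleftrightarrow>
     f \<in> {0..} \<rightarrow> {0..} \<and>
     (\<forall>(M :: 'b set) \<rho>. Metric_space M \<rho> \<longrightarrow> Metric_space M (\<lambda>x y. f (\<rho> x y)))"
  using metric_preservingD[of f] metric_preserving_transfer[where 'c = 'b, OF assms]
  unfolding metric_preserving_def by blast

end

theory Submission imports Defs begin

text \<open>
  The contraction constant is the \<open>c\<close> of condition (b'). Let \<open>t = d x u\<close> and \<open>s = d (g x) (g u)\<close>,
  so \<open>f s \<le> k t\<close> for small \<open>t\<close>. If \<open>s\<close> is itself small and \<open>s > c t\<close>, then (b') at \<open>s / c\<close> gives
  \<open>f s \<ge> k s / c > k t\<close>, a contradiction. That \<open>s\<close> is small follows from \<open>f a \<le> 2 f b\<close> for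
  \<open>a \<le> 2 b\<close>, which bounds \<open>f\<close> away from \<open>0\<close> outside every neighbourhood of \<open>0\<close>.
\<close>

text \<open>An isosceles triangle with base \<open>a\<close> and legs \<open>b\<close> is a metric
  space as \<open>a \<le> 2 * b\<close>; apply the triangle inequality to its image under
  \<open>f\<close>.\<close>

lemma metric_preserving_le_double:
  assumes f: "metric_preserving f" and "0 < a" "a \<le> 2 * b"
  shows "f a \<le> 2 * f b"
proof -
  define \<rho> :: "real \<Rightarrow> real \<Rightarrow> real"
    where "\<rho> x y = (if x = y then 0 else if x \<noteq> 2 \<and> y \<noteq> 2 then a else b)" for x y
  have "Metric_space {0, 1, 2} \<rho>"
    using assms(2,3) by unfold_locales (auto simp: \<rho>_def)
  from metric_preservingD[OF f this]
  have "f (\<rho> 0 1) \<le> f (\<rho> 0 2) + f (\<rho> 2 1)"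
    by (rule Metric_space.triangle) auto
  then show ?thesis by (simp add: \<rho>_def)
qed

theorem theorem18:
  fixes X :: "'a set" and d :: "'a \<Rightarrow> 'a \<Rightarrow> real" and g :: "'a \<Rightarrow> 'a"
    and k :: real and f :: "real \<Rightarrow> real"
  assumes "Metric_space X d"
    and "g \<in> X \<rightarrow> X"
    and "0 < k" and "k < 1"
    and "metric_preserving f"
    and "\<forall>x\<in>X. \<exists>\<epsilon>>0. \<forall>u\<in>X. d x u < \<epsilon> \<longrightarrow> f (d (g x) (g u)) \<le> k * d x u"
    and "\<exists>c. 0 < c \<and> c < 1 \<and> (\<forall>\<^sub>F t in at_right 0. f (c * t) \<ge> k * t)"
  shows "local_radial_contraction X d g"
proof -
  interpret Metric_space X d by fact
  obtain c b where c: "0 < c" "c < 1" and "0 < b"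
    and fc: "\<And>t. 0 < t \<Longrightarrow> t < b \<Longrightarrow> k * t \<le> f (c * t)"
    using assms(7) by (auto simp: eventually_at_right_field)
  \<comment> \<open>Any point strictly between \<open>0\<close> and \<open>b\<close> would do:
    \<open>fc\<close> is applied at \<open>r\<close> itself.\<close>
  define r where "r = b / 2"
  have r: "0 < r" "r < b" using \<open>0 < b\<close> by (auto simp: r_def)
  have "\<exists>\<epsilon>>0. \<forall>u\<in>X. d x u < \<epsilon> \<longrightarrow> d (g x) (g u) \<le> c * d x u" if x: "x \<in> X" for x
  proof -
    obtain e where "0 < e"
      and e: "\<And>u. u \<in> X \<Longrightarrow> d x u < e \<Longrightarrow> f (d (g x) (g u)) \<le> k * d x u"
      using bspec[OF assms(6) x] by blast
    \<comment> \<open>The bound \<open>r / 2\<close> serves the case \<open>c * r \<le> s\<close>,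
      where \<open>k * r \<le> f (c * r) \<le> 2 * f s \<le> 2 * k * t\<close>.\<close>
    have "d (g x) (g u) \<le> c * d x u" if u: "u \<in> X" "d x u < min e (r / 2)" for u
    proof (rule ccontr)
      define s t where "s = d (g x) (g u)" and "t = d x u"
      assume "\<not> d (g x) (g u) \<le> c * d x u"
      then have *: "c * t < s" by (simp add: s_def t_def)
      have t: "0 \<le> t" "t < r / 2" and fs: "f s \<le> k * t"
        using u e by (auto simp: s_def t_def)
      have "0 < s" using * c(1) t(1) by (intro le_less_trans[OF mult_nonneg_nonneg]) auto
      show False
      proof (cases "s < c * r")
        case True
        then have "k * (s / c) \<le> f s"
          using fc[of "s / c"] c(1) r(2) \<open>0 < s\<close> mult_strict_left_mono[OF r(2) c(1)]
          by (simp add: pos_divide_less_eq mult.commute[of b c])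
        moreover have "k * t < k * (s / c)"
          using * c(1) assms(3) by (simp add: field_simps)
        ultimately show False using fs by linarith
      next
        case False
        then have "f (c * r) \<le> 2 * f s"
          using c r \<open>0 < s\<close> by (intro metric_preserving_le_double[OF assms(5)]) auto
        moreover have "k * r \<le> f (c * r)" using fc r by blast
        moreover have "k * t < k * (r / 2)" using t(2) assms(3) by simp
        ultimately show False using fs by simp
      qed
    qed
    then show ?thesis using \<open>0 < e\<close> r(1) by (intro exI[of _ "min e (r / 2)"]) auto
  qed
  then show ?thesis
    using c assms(2) unfolding local_radial_contraction_def by blast
qed

end
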